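(* Let $(F_n)_{n\geq 1}$ be the sequence of polynomials in one variable $x$ with $F_1=1$ and $$(x-1)^2F_{n+1}(x)=(x^{2n+2}+1)F_n(1)-2x^2F_n(x)\qquad (n\geq 1).$$ Then for every $n\geq 1$, all complex roots of $F_n(x)$ lie on the unit circle $\{z\in\mathbb{C}: |z|=1\}$.
   Context: The recurrence determines $F_{n+1}$ uniquely; the right-hand side is always divisible by $(x-1)^2$, so each $F_n$ is a polynomial (with integer coefficients, palindromic, of degree $2n-2$). These are the Poupard polynomials; e.g. $F_2=x^2+2x+1$, $F_3=4x^4+8x^3+10x^2+8x+4$. *)

theory Defs
  imports Complex_Main "HOL-Computational_Algebra.Polynomial"
begin

end

theory Submission
  imports Defs
begin

text \<open>
  On the unit circle write $F_n(e^{it}) = e^{i(n-1)t} G_n(t)$ with $G_n$ real. The recurrence becomes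
  $(1 - \cos t)\, G_{n+1}(t) = G_n(t) - G_n(0) \cos((n+1)t)$. The coefficients of $F_n$ are positive
  (those of $F_{n+1}$ form a concave sequence vanishing at position $2n+1$), so
  $|G_n(t)| < G_n(0)$ for $0 < t < 2\pi$ and $n \ge 2$. Hence $G_{n+1}$ alternates in sign at the
  $2n+1$ points $k\pi/(n+1)$ in $(0, 2\pi)$, which yields $2n = \deg F_{n+1}$ distinct roots of
  $F_{n+1}$ on the circle.
\<close>

section \<open>Positivity and strict bounds on the circle\<close>

text \<open>At the first nonpositive index the sequence has just dropped. Concavity makes every
  later step a strict drop too, which would force \<open>f N\<close> below zero.\<close>

lemma concave_seq_pos:
  fixes f :: "nat \<Rightarrow> real"
  assumes conc: "\<And>k. k + 2 \<le> N \<Longrightarrow> f k - 2 * f (k + 1) + f (k + 2) \<le> 0"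
    and f0: "f 0 > 0" and fN: "f N \<ge> 0" and "i < N"
  shows "f i > 0"
proof (rule ccontr)
  assume "\<not> f i > 0"
  define j where "j = (LEAST j. f j \<le> 0)"
  have "f i \<le> 0" using \<open>\<not> f i > 0\<close> by simp
  then have fj: "f j \<le> 0" and "j \<le> i"
    unfolding j_def by (rule LeastI, rule Least_le)
  have "j \<noteq> 0" using f0 fj by (metis not_le)
  then obtain l where l: "j = Suc l" by (cases j) auto
  have "f l > 0"
    using not_less_Least[of l "\<lambda>j. f j \<le> 0"] l j_def by auto
  have "Suc (l + d) \<le> N \<longrightarrow> f (Suc (l + d)) \<le> 0 \<and> f (Suc (l + d)) < f (l + d)" for d
  proof (induction d)
    case 0
    show ?case using fj \<open>f l > 0\<close> l by simp
  next
    case (Suc d)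
    then show ?case using conc[of "l + d"] by auto
  qed
  note decr = this
  \<comment> \<open>Since \<open>j\<close> is at most \<open>i\<close> and \<open>i < N\<close>, at
    least one further drop follows index \<open>j = Suc l\<close>; it makes \<open>f N\<close>
    strictly negative.\<close>
  define d where "d = N - Suc (Suc l)"
  have "N = Suc (l + Suc d)" using \<open>j \<le> i\<close> \<open>i < N\<close> l by (simp add: d_def)
  then have "f N < 0" using decr[of d] decr[of "Suc d"] by simp
  then show False using fN by simp
qed

text \<open>Coefficients are complex throughout, so being real is a separate clause. Positivity has
  no gaps up to the degree, which excludes the zero polynomial.\<close>

definition pos_coeffs :: "complex poly \<Rightarrow> bool" where
  "pos_coeffs p \<longleftrightarrow> (\<forall>i. coeff p i \<in> \<real>) \<and> (\<forall>i\<le>degree p. Re (coeff p i) > 0)"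

lemma pos_coeffs_eq_of_real: "pos_coeffs p \<Longrightarrow> coeff p i = of_real (Re (coeff p i))"
  by (simp add: pos_coeffs_def of_real_Re)

lemma pos_coeffs_poly_1:
  assumes "pos_coeffs p"
  shows "poly p 1 = of_real (\<Sum>i\<le>degree p. Re (coeff p i))"
    and "(\<Sum>i\<le>degree p. Re (coeff p i)) > 0"
    and "poly p 1 \<noteq> 0"
proof -
  show eq: "poly p 1 = of_real (\<Sum>i\<le>degree p. Re (coeff p i))"
    unfolding poly_altdef of_real_sum
    using pos_coeffs_eq_of_real[OF assms] by (intro sum.cong) simp_all
  show pos: "(\<Sum>i\<le>degree p. Re (coeff p i)) > 0"
    using assms by (intro sum_pos) (auto simp: pos_coeffs_def)
  show "poly p 1 \<noteq> 0" unfolding eq of_real_eq_0_iff using pos by simp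
qed

text \<open>The squared norm is \<open>a^2 + b^2 + 2 * a * b * Re z\<close>, and
  \<open>Re z < 1\<close> on the circle away from 1.\<close>

lemma norm_add_mult_unit_less:
  fixes z :: complex and a b :: real
  assumes "a > 0" "b > 0" "norm z = 1" "z \<noteq> 1"
  shows "norm (of_real a + of_real b * z) < a + b"
proof -
  have z: "(Re z)\<^sup>2 + (Im z)\<^sup>2 = 1"
    using assms(3) by (metis cmod_power2 one_power2)
  have "Re z < 1"
  proof (rule ccontr)
    assume "\<not> Re z < 1"
    moreover have "Re z \<le> 1" using complex_Re_le_cmod[of z] assms(3) by simp
    ultimately have "Re z = 1" by simp
    with z have "z = 1" by (simp add: complex_eq_iff)
    with assms(4) show False by simp
  qed
  have "(norm (of_real a + of_real b * z))\<^sup>2 = a\<^sup>2 + b\<^sup>2 * ((Re z)\<^sup>2 + (Im z)\<^sup>2) + 2 * a * b * Re z"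
    unfolding cmod_power2 by (simp add: power2_eq_square algebra_simps)
  also have "\<dots> < (a + b)\<^sup>2"
    using mult_strict_left_mono[OF \<open>Re z < 1\<close>, of "2 * a * b"] assms(1,2)
    by (simp add: z power2_sum)
  finally show ?thesis
    by (rule power_less_imp_less_base) (use assms(1,2) in simp)
qed

text \<open>Strictness comes from the terms of degree 0 and 1 alone; the ordinary triangle
  inequality suffices for the rest.\<close>

lemma norm_poly_less_of_pos_coeffs:
  assumes p: "pos_coeffs p" and d: "degree p \<ge> 1" and z: "norm z = 1" "z \<noteq> 1"
  shows "norm (poly p z) < (\<Sum>i\<le>degree p. Re (coeff p i))"
proof -
  let ?a = "\<lambda>i. Re (coeff p i)"
  have split: "{..degree p} = {0, 1} \<union> {2..degree p}" using d by auto
  have pos: "?a i > 0" if "i \<le> degree p" for i using p that by (simp add: pos_coeffs_def)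
  have "poly p z = (\<Sum>i\<le>degree p. of_real (?a i) * z ^ i)"
    unfolding poly_altdef using pos_coeffs_eq_of_real[OF p] by (intro sum.cong) simp_all
  also have "\<dots> = (of_real (?a 0) + of_real (?a 1) * z) + (\<Sum>i=2..degree p. of_real (?a i) * z ^ i)"
    unfolding split by (subst sum.union_disjoint) auto
  finally have "norm (poly p z) \<le> norm (of_real (?a 0) + of_real (?a 1) * z)
      + norm (\<Sum>i=2..degree p. of_real (?a i) * z ^ i)"
    by (metis norm_triangle_ineq)
  also have "\<dots> < (?a 0 + ?a 1) + (\<Sum>i=2..degree p. ?a i)"
  proof (rule add_less_le_mono)
    show "norm (of_real (?a 0) + of_real (?a 1) * z) < ?a 0 + ?a 1"
      using pos d z by (intro norm_add_mult_unit_less) auto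
    have "norm (\<Sum>i=2..degree p. of_real (?a i) * z ^ i)
        \<le> (\<Sum>i=2..degree p. norm (of_real (?a i) * z ^ i))"
      by (rule norm_sum)
    also have "\<dots> = (\<Sum>i=2..degree p. ?a i)"
      using z pos by (intro sum.cong) (auto simp: norm_mult norm_power intro!: abs_of_pos)
    finally show "norm (\<Sum>i=2..degree p. of_real (?a i) * z ^ i) \<le> (\<Sum>i=2..degree p. ?a i)" .
  qed
  also have "\<dots> = (\<Sum>i\<le>degree p. ?a i)"
    unfolding split by (subst sum.union_disjoint) auto
  finally show ?thesis .
qed

section \<open>The recurrence on coefficients\<close>

text \<open>The passage from $F_n$ to $F_{n+1}$, kept as a relation so that no division by $(x-1)^2$
  is needed.\<close>

definition poupard_step :: "nat \<Rightarrow> complex poly \<Rightarrow> complex poly \<Rightarrow> bool" where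
  "poupard_step n p q \<longleftrightarrow> [:-1, 1:] ^ 2 * q =
     smult (poly p 1) (monom 1 (2 * n + 2) + 1) - smult 2 (monom 1 2 * p)"

text \<open>Multiplication by $(x-1)^2$ takes second differences. Reading off the coefficient of
  $x^{k+2}$ puts the term $x^{2n+2}$ at \<open>k = 2 * n\<close>.\<close>

lemma poupard_step_coeff:
  assumes "poupard_step n p q"
  shows "coeff q 0 = poly p 1" and "coeff q 1 = 2 * poly p 1"
    and "coeff q k - 2 * coeff q (k + 1) + coeff q (k + 2)
      = (if k = 2 * n then poly p 1 else 0) - 2 * coeff p k"
proof -
  have eq: "pCons 0 (pCons 0 q) - smult 2 (pCons 0 q) + q
      = smult (poly p 1) (monom 1 (2 * n + 2) + 1) - smult 2 (monom 1 2 * p)"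
    using assms by (simp add: poupard_step_def power2_eq_square algebra_simps flip: smult_add_left)
  show c0: "coeff q 0 = poly p 1"
    using arg_cong[OF eq, of "\<lambda>r. coeff r 0"] by (simp add: coeff_monom_mult)
  show "coeff q 1 = 2 * poly p 1"
    using arg_cong[OF eq, of "\<lambda>r. coeff r 1"] c0 by (simp add: coeff_monom_mult)
  show "coeff q k - 2 * coeff q (k + 1) + coeff q (k + 2)
      = (if k = 2 * n then poly p 1 else 0) - 2 * coeff p k"
    using arg_cong[OF eq, of "\<lambda>r. coeff r (k + 2)"] by (simp add: coeff_monom_mult)
qed

text \<open>The term $x^{2n+2}$ survives because \<open>poly p 1\<close> is nonzero and $x^2 p$ has
  smaller degree; the factor $(x-1)^2$ accounts for two.\<close>

lemma poupard_step_degree: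
  assumes st: "poupard_step n p q" and "degree p < 2 * n" and "poly p 1 \<noteq> 0"
  shows "degree q = 2 * n"
proof -
  let ?r = "smult (poly p 1) (monom 1 (2 * n + 2) + 1) - smult 2 (monom 1 2 * p)"
  have p0: "p \<noteq> 0" using assms(3) by auto
  have d1: "degree (smult (poly p 1) (monom 1 (2 * n + 2) + 1)) = 2 * n + 2"
    using assms(3) by (simp add: degree_monom_eq degree_add_eq_left)
  have d2: "degree (smult 2 (monom 1 2 * p)) < 2 * n + 2"
    using assms(2) p0 by (simp add: degree_mult_eq degree_monom_eq)
  have "degree ?r = 2 * n + 2"
    using degree_add_eq_left[of "- smult 2 (monom 1 2 * p)"] d1 d2 by simp
  then have dq: "degree ([:-1, 1:] ^ 2 * q) = 2 * n + 2"
    using st by (simp add: poupard_step_def)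
  then have "q \<noteq> 0" by auto
  then show ?thesis using dq by (simp add: degree_mult_eq degree_power_eq)
qed

lemma poupard_step_pos_coeffs:
  assumes st: "poupard_step n p q" and d: "degree p < 2 * n" and p: "pos_coeffs p"
  shows "pos_coeffs q"
proof -
  let ?S = "\<Sum>i\<le>degree p. Re (coeff p i)"
  note S = pos_coeffs_poly_1[OF p]
  note c = poupard_step_coeff[OF st]
  \<comment> \<open>The recurrence for the coefficients has order two, so the induction carries two
    consecutive ones.\<close>
  have real: "coeff q k \<in> \<real> \<and> coeff q (k + 1) \<in> \<real>" for k
  proof (induction k)
    case 0
    show ?case using c(1,2) S(1) by simp
  next
    case (Suc k)
    have "coeff q (k + 2) = 2 * coeff q (k + 1) - coeff q k
        + ((if k = 2 * n then poly p 1 else 0) - 2 * coeff p k)"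
      using c(3)[of k] by (simp add: algebra_simps)
    also have "\<dots> \<in> \<real>"
      using Suc p S(1) by (intro Reals_diff Reals_add Reals_mult) (auto simp: pos_coeffs_def)
    finally show ?case using Suc by simp
  qed
  have dq: "degree q = 2 * n" using poupard_step_degree[OF st d S(3)] .
  have "Re (coeff q i) > 0" if "i \<le> 2 * n" for i
  \<comment> \<open>The endpoint is one past the degree, where the coefficient is 0. It also keeps
    \<open>k\<close> below \<open>2 * n\<close>, the only index with a positive contribution to the
    second difference.\<close>
  proof (rule concave_seq_pos[of "2 * n + 1"])
    fix k assume k: "k + 2 \<le> 2 * n + 1"
    have "Re (coeff p k) \<ge> 0"
      using p by (cases "k \<le> degree p") (auto simp: pos_coeffs_def coeff_eq_0 intro: less_imp_le)
    then show "Re (coeff q k) - 2 * Re (coeff q (k + 1)) + Re (coeff q (k + 2)) \<le> 0"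
      using arg_cong[OF c(3)[of k], of Re] k by simp
  next
    show "Re (coeff q 0) > 0" using c(1) S by simp
    show "Re (coeff q (2 * n + 1)) \<ge> 0" by (simp add: coeff_eq_0 dq)
  qed (use that in simp)
  then show ?thesis using real dq by (simp add: pos_coeffs_def)
qed

section \<open>The recurrence on the unit circle\<close>

text \<open>For \<open>p\<close> equal to $F_n$ and \<open>m = n - 1\<close>, half its degree, this
  is $G_n$, still complex-valued; its reality is proved by induction.\<close>

definition circle_fun :: "nat \<Rightarrow> complex poly \<Rightarrow> real \<Rightarrow> complex" where
  "circle_fun m p t = cis (- (real m * t)) * poly p (cis t)"

lemma norm_circle_fun: "norm (circle_fun m p t) = norm (poly p (cis t))"
  by (simp add: circle_fun_def norm_mult)

lemma poupard_step_circle: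
  assumes st: "poupard_step (Suc m) p q"
  shows "of_real (1 - cos t) * circle_fun (Suc m) q t
    = circle_fun m p t - poly p 1 * of_real (cos (real (m + 2) * t))"
proof -
  \<comment> \<open>With \<open>n = Suc m\<close>, the factor \<open>?w\<close> is $z^{-(n+1)}$: it
    turns $z^{2n+2}+1$ into twice a cosine and leaves the normalising factors of \<open>p\<close>
    and \<open>q\<close>.\<close>
  let ?z = "cis t" and ?w = "cis (- (real (m + 2) * t))"
  have "(?z - 1)\<^sup>2 * poly q ?z
      = poly p 1 * (?z ^ (2 * m + 4) + 1) - 2 * (?z\<^sup>2 * poly p ?z)"
    using arg_cong[OF st[unfolded poupard_step_def], of "\<lambda>r. poly r ?z"]
    by (simp add: poly_monom power_add numeral_eq_Suc algebra_simps)
  then have e: "?w * ((?z - 1)\<^sup>2 * poly q ?z)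
      = ?w * (poly p 1 * (?z ^ (2 * m + 4) + 1) - 2 * (?z\<^sup>2 * poly p ?z))"
    by simp
  have cos2: "2 * of_real (cos x) = cis x + cis (- x)" for x
    by (simp add: complex_eq_iff)
  have w: "?w * ?z = cis (- (real (Suc m) * t))" "?w * ?z\<^sup>2 = cis (- (real m * t))"
    "?w * ?z ^ (2 * m + 4) = cis (real (m + 2) * t)"
    by (simp_all add: cis_mult Complex.DeMoivre algebra_simps)
  have z: "(?z - 1)\<^sup>2 = - (?z * (2 * of_real (1 - cos t)))"
  proof -
    have "?z * cis (- t) = 1" by (simp add: cis_mult)
    then have "?z * (2 * of_real (cos t)) = ?z * ?z + 1"
      unfolding cos2 by (simp add: distrib_left)
    then show ?thesis by (simp add: algebra_simps power2_eq_square)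
  qed
  define c where "c = complex_of_real (1 - cos t)"
  have "- (2 * (c * ((?w * ?z) * poly q ?z))) = ?w * ((?z - 1)\<^sup>2 * poly q ?z)"
    unfolding z c_def by (simp add: ac_simps)
  also have "\<dots> = poly p 1 * (?w * ?z ^ (2 * m + 4) + ?w) - 2 * ((?w * ?z\<^sup>2) * poly p ?z)"
    unfolding e by (simp add: distrib_left right_diff_distrib ac_simps)
  also have "\<dots> = - (2 * (circle_fun m p t - poly p 1 * of_real (cos (real (m + 2) * t))))"
    unfolding w circle_fun_def right_diff_distrib cos2[symmetric] by (simp add: ac_simps)
  finally have "c * ((?w * ?z) * poly q ?z)
      = circle_fun m p t - poly p 1 * of_real (cos (real (m + 2) * t))"
    by (simp only: neg_equal_iff_equal mult_left_cancel zero_neq_numeral[symmetric] not_False_eq_True)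
  then show ?thesis unfolding w(1) c_def circle_fun_def[of "Suc m"] .
qed

section \<open>Sign changes and distinct zeros\<close>

text \<open>The intermediate value theorem gives a zero in each gap between consecutive sample
  points; the gaps are disjoint, so the zeros are distinct.\<close>

lemma alternating_zeros:
  fixes g :: "real \<Rightarrow> real" and s :: "nat \<Rightarrow> real"
  assumes cont: "continuous_on UNIV g" and s: "strict_mono s"
    and alt: "\<And>k. k \<le> N \<Longrightarrow> (-1) ^ k * g (s k) > 0"
  obtains r where "\<And>k. k < N \<Longrightarrow> g (r k) = 0 \<and> s k < r k \<and> r k < s (Suc k)"
    and "inj_on r {..<N}"
proof -
  have "\<exists>x. g x = 0 \<and> s k < x \<and> x < s (Suc k)" if k: "k < N" for k
  proof -
    let ?h = "\<lambda>x. (-1) ^ k * g x"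
    have lt: "s k < s (Suc k)" using s by (simp add: strict_mono_less)
    have h: "?h (s k) > 0" "?h (s (Suc k)) < 0"
      using alt[of k] alt[of "Suc k"] k by auto
    have "continuous_on {s k..s (Suc k)} ?h"
      by (intro continuous_intros continuous_on_subset[OF cont]) auto
    then obtain x where x: "s k \<le> x" "x \<le> s (Suc k)" "?h x = 0"
      using IVT2'[of ?h "s (Suc k)" 0 "s k"] h lt by auto
    moreover have "x \<noteq> s k" "x \<noteq> s (Suc k)" using h x(3) by auto
    ultimately show ?thesis by (intro exI[of _ x]) auto
  qed
  then obtain r where r: "\<And>k. k < N \<Longrightarrow> g (r k) = 0 \<and> s k < r k \<and> r k < s (Suc k)" by metis
  have "r k < r l" if "k < l" "l < N" for k l
  proof -
    have "s (Suc k) \<le> s l" using that s by (simp add: strict_mono_less_eq)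
    then show ?thesis using r[of k] r[of l] that by force
  qed
  then have "inj_on r {..<N}"
    by (intro linorder_inj_onI) force+
  with r show thesis by (rule that)
qed

lemma cos_less_1:
  assumes "0 < t" "t < 2 * pi"
  shows "cos t < 1"
proof (rule ccontr)
  assume "\<not> cos t < 1"
  then have "cos t = 1" using cos_le_one[of t] by linarith
  then obtain k :: int where k: "t = of_int k * 2 * pi" using cos_one_2pi_int by blast
  have "k > 0" using assms(1) k by (simp add: zero_less_mult_iff)
  moreover have "of_int k * (2 * pi) < 1 * (2 * pi)" using assms(2) k by simp
  then have "(of_int k :: real) < 1" by (rule mult_right_less_imp_less) simp
  then have "k < 1" by simp
  ultimately show False by simp
qed

text \<open>Equal values give \<open>cos (a - b) = 1\<close> with \<open>a\<close> and
  \<open>b\<close> less than a full turn apart. This turns distinct angles into distinct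
  roots.\<close>

lemma inj_on_cis: "inj_on cis {0<..<2 * pi}"
proof (rule inj_onI)
  fix a b assume ab: "a \<in> {0<..<2 * pi}" "b \<in> {0<..<2 * pi}" "cis a = cis b"
  then have "cos (a - b) = (cos b)\<^sup>2 + (sin b)\<^sup>2"
    by (simp add: cos_diff power2_eq_square complex_eq_iff)
  then have "cos \<bar>a - b\<bar> = 1" by simp
  moreover have "\<bar>a - b\<bar> < 2 * pi" using ab by (auto simp: abs_less_iff)
  ultimately show "a = b" using cos_less_1[of "\<bar>a - b\<bar>"] by (cases "a = b") auto
qed

text \<open>Where \<open>cos t\<close> is not 1, divide the circle identity by
  \<open>1 - cos t\<close>. Otherwise \<open>cis t = 1\<close> and the value is the real number
  \<open>poly q 1\<close>.\<close>

lemma poupard_step_circle_real: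
  assumes st: "poupard_step (Suc m) p q" and p: "pos_coeffs p" and q: "pos_coeffs q"
    and real: "\<And>t. circle_fun m p t \<in> \<real>"
  shows "circle_fun (Suc m) q t \<in> \<real>"
proof (cases "cos t = 1")
  case True
  then have "sin t = 0" using sin_cos_squared_add[of t] by simp
  with True have 1: "cis t = 1" by (simp add: complex_eq_iff)
  have "cis (- (real (Suc m) * t)) = inverse (cis t ^ Suc m)"
    by (simp add: Complex.DeMoivre del: power_Suc of_nat_Suc)
  then show ?thesis using 1 pos_coeffs_poly_1(1)[OF q] by (simp add: circle_fun_def)
next
  case False
  let ?c = "complex_of_real (1 - cos t)"
  have "?c \<noteq> 0" using False by (metis eq_iff_diff_eq_0 of_real_eq_0_iff)
  then have "circle_fun (Suc m) q t
      = (circle_fun m p t - poly p 1 * of_real (cos (real (m + 2) * t))) / ?c"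
    unfolding poupard_step_circle[OF st, symmetric] by simp
  also have "\<dots> \<in> \<real>"
    unfolding pos_coeffs_poly_1(1)[OF p]
    by (intro Reals_divide Reals_diff Reals_mult Reals_of_real real)
  finally show ?thesis .
qed

text \<open>Sign changes on the circle already produce as many distinct roots as the degree of
  \<open>q\<close>, so none is left elsewhere.\<close>

lemma poupard_step_roots:
  assumes st: "poupard_step (Suc m) p q" and d: "degree p = 2 * m" "m \<ge> 1"
    and p: "pos_coeffs p" and real: "\<And>t. circle_fun m p t \<in> \<real>"
    and z: "poly q z = 0"
  shows "norm z = 1"
proof -
  let ?S = "\<Sum>i\<le>degree p. Re (coeff p i)" and ?N = "2 * m + 2"
  let ?g = "\<lambda>t. Re (circle_fun (Suc m) q t)"
  \<comment> \<open>The points where \<open>cos (real (m + 2) * t)\<close> is 1 or -1; the indices 0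
    to \<open>?N\<close> give those strictly between 0 and \<open>2 * pi\<close>.\<close>
  define s where "s k = real (Suc k) * pi / real (m + 2)" for k
  note S = pos_coeffs_poly_1[OF p]
  have dq: "degree q = ?N" using poupard_step_degree[OF st _ S(3)] d by simp
  have q: "pos_coeffs q" using poupard_step_pos_coeffs[OF st _ p] d by simp
  have mono: "strict_mono s"
    unfolding s_def by (intro strict_monoI divide_strict_right_mono mult_strict_right_mono) auto
  have s_pos: "s 0 > 0" by (simp add: s_def)
  have s_less: "s ?N < 2 * pi" by (simp add: s_def field_simps)
  have cont: "continuous_on UNIV ?g"
    unfolding circle_fun_def by (intro continuous_intros)
  have alt: "(-1) ^ k * ?g (s k) > 0" if k: "k \<le> ?N" for k
  proof -
    have "s 0 \<le> s k" "s k \<le> s ?N" using mono k by (simp_all only: strict_mono_less_eq)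
    then have t: "0 < s k" "s k < 2 * pi" using s_pos s_less by linarith+
    have cos: "cos (real (m + 2) * s k) = - ((-1) ^ k)"
      using cos_npi[of "Suc k"] by (simp add: s_def)
    have "cis (s k) \<noteq> 1" using cos_less_1[OF t] by (auto simp: complex_eq_iff)
    then have "norm (circle_fun m p (s k)) < ?S"
      unfolding norm_circle_fun using d by (intro norm_poly_less_of_pos_coeffs[OF p]) auto
    then have "\<bar>Re (circle_fun m p (s k))\<bar> < ?S"
      using abs_Re_le_cmod le_less_trans by blast
    then have "\<bar>(-1) ^ k * Re (circle_fun m p (s k))\<bar> < ?S" by (simp add: abs_mult)
    moreover have "(1 - cos (s k)) * ?g (s k) = Re (circle_fun m p (s k)) + ?S * (-1) ^ k"
      using arg_cong[OF poupard_step_circle[OF st, of "s k"], of Re]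
      unfolding cos S(1) by (simp del: of_real_sum)
    \<comment> \<open>After this sign change \<open>?S\<close> strictly dominates the other term,
      which fixes the sign of \<open>?g (s k)\<close>.\<close>
    then have "(1 - cos (s k)) * ((-1) ^ k * ?g (s k)) = (-1) ^ k * Re (circle_fun m p (s k)) + ?S"
      by (cases "even k") (simp_all add: algebra_simps)
    ultimately have "(1 - cos (s k)) * ((-1) ^ k * ?g (s k)) > 0" by linarith
    then show ?thesis using cos_less_1[OF t] by (simp add: zero_less_mult_iff)
  qed
  obtain r where r: "\<And>k. k < ?N \<Longrightarrow> ?g (r k) = 0 \<and> s k < r k \<and> r k < s (Suc k)"
    and inj: "inj_on r {..<?N}"
    using alternating_zeros[OF cont mono alt] by blast
  have r_bounds: "0 < r k \<and> r k < 2 * pi" if k: "k < ?N" for k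
  proof -
    have "s 0 \<le> s k" "s (Suc k) \<le> s ?N"
      using mono k by (simp_all only: strict_mono_less_eq Suc_le_eq)
    then show ?thesis using r[OF k] s_pos s_less by linarith
  qed
  have "inj_on cis (r ` {..<?N})"
    using r_bounds by (intro inj_on_subset[OF inj_on_cis]) auto
  then have card: "card (cis ` r ` {..<?N}) = ?N"
    using inj by (simp add: card_image)
  have sub: "cis ` r ` {..<?N} \<subseteq> {x. poly q x = 0}"
  proof clarsimp
    fix k assume "k < Suc (Suc (2 * m))"
    then have "?g (r k) = 0" using r[of k] by simp
    moreover have "Im (circle_fun (Suc m) q (r k)) = 0"
      using poupard_step_circle_real[OF st p q real] complex_is_Real_iff by blast
    ultimately have "circle_fun (Suc m) q (r k) = 0" by (simp add: complex_eq_iff)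
    then show "poly q (cis (r k)) = 0" by (simp add: circle_fun_def)
  qed
  have "q \<noteq> 0" using dq by auto
  then have "finite {x. poly q x = 0}" "card {x. poly q x = 0} \<le> ?N"
    using poly_roots_finite card_poly_roots_bound dq by metis+
  \<comment> \<open>The \<open>?N\<close> roots found exhaust the degree bound.\<close>
  then have "cis ` r ` {..<?N} = {x. poly q x = 0}"
    using sub card by (intro card_seteq) auto
  then have "z \<in> cis ` r ` {..<?N}" using z by blast
  then show ?thesis by auto
qed

theorem theorem1:
  fixes F :: "nat \<Rightarrow> complex poly"
  assumes F_1: "F 1 = 1"
    and F_rec: "\<And>n. n \<ge> 1 \<Longrightarrow>
      [:-1, 1:] ^ 2 * F (n + 1) =
        smult (poly (F n) 1) (monom 1 (2 * n + 2) + 1) - smult 2 (monom 1 2 * F n)"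
  shows "\<forall>n\<ge>1. \<forall>z. poly (F n) z = 0 \<longrightarrow> norm z = 1"
proof (intro allI impI)
  fix n z assume n: "n \<ge> 1" and z: "poly (F n) z = 0"
  have st: "poupard_step (Suc m) (F (Suc m)) (F (Suc (Suc m)))" for m
    using F_rec[of "Suc m"] by (simp add: poupard_step_def)
  \<comment> \<open>The three properties are carried together: the degree bound feeds positivity,
    and positivity feeds both the next degree and reality.\<close>
  have inv: "degree (F (Suc m)) = 2 * m \<and> pos_coeffs (F (Suc m))
      \<and> (\<forall>t. circle_fun m (F (Suc m)) t \<in> \<real>)" for m
  proof (induction m)
    case 0
    show ?case using F_1 by (simp add: pos_coeffs_def circle_fun_def coeff_1)
  next
    case (Suc m)
    then have p: "pos_coeffs (F (Suc m))" and d: "degree (F (Suc m)) < 2 * Suc m"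
      and real: "\<And>t. circle_fun m (F (Suc m)) t \<in> \<real>" by simp_all
    have q: "pos_coeffs (F (Suc (Suc m)))" by (rule poupard_step_pos_coeffs[OF st d p])
    then show ?case
      using poupard_step_degree[OF st d pos_coeffs_poly_1(3)[OF p]]
        poupard_step_circle_real[OF st p q real] by blast
  qed
  obtain m where m: "n = Suc m" using n by (cases n) auto
  \<comment> \<open>The alternation argument needs a nonconstant predecessor, so it starts at
    $F_3$.\<close>
  consider "m = 0" | "m = 1" | l where "m = Suc l" "l \<ge> 1" by (cases m; force)
  then show "norm z = 1"
  proof cases
    case 1
    then show ?thesis using z m F_1 by simp
  next
    case 2
    \<comment> \<open>Here the strict bound on the circle fails, as $|F_1| = F_1(1)$.\<close>
    have "(z - 1)\<^sup>2 * poly (F 2) z = (z - 1)\<^sup>2 * (z + 1)\<^sup>2"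
      using arg_cong[OF F_rec[of 1], of "\<lambda>r. poly r z"] F_1
      by (simp add: poly_monom numeral_2_eq_2 algebra_simps)
    \<comment> \<open>The previous identity says nothing at \<open>z = 1\<close>, so that point is
      excluded separately.\<close>
    moreover have "poly (F 2) 1 \<noteq> 0"
      using pos_coeffs_poly_1(3)[of "F 2"] inv[of 1] by (simp add: numeral_2_eq_2)
    ultimately have "z + 1 = 0" using z m 2 by (auto simp: numeral_2_eq_2)
    then have "z = - 1" by (simp add: eq_neg_iff_add_eq_0)
    then show ?thesis by simp
  next
    case 3
    then show ?thesis using poupard_step_roots[OF st[of l]] inv[of l] z m by blast
  qed
qed

end
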